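(* Let $G$ be a loopless non-bipartite multigraph, let $d>1$ be an odd integer, and let $\Delta(G)=md+s$, where $m\ge 0$ and $0\le s<d$ are integers. Let \[ \ell:=\max\{1,\Gamma_d(G)-m\}. \] Then $\ell d-s>0$. If moreover \[ g_0(G)\ge\left\lceil\frac{m+\ell-1}{\ell d-s}\right\rceil, \] then $\chi'_d(G)\le m+\ell$, and hence \[ \chi'_d(G)\le\max\left\{\Gamma_d(G),\left\lceil\frac{\Delta(G)+1}{d}\right\rceil\right\}. \]
   Context: Multigraphs are finite; parallel edges are allowed, loops are not. $\Delta(G)$ is the maximum degree of $G$, where degrees count edges with multiplicity. For a non-bipartite multigraph $G$, the odd girth $g_0(G)$ is the length of a shortest odd cycle of $G$. For a positive integer $d$, a $d$-defective edge coloring of $G$ is an assignment of colors to the edges of $G$ such that, for each color, the subgraph formed by the edges of that color has maximum degree at most $d$. The $d$-defective chromatic index $\chi'_d(G)$ is the least $k$ such that $G$ has a $d$-defective edge coloring using at most $k$ colors. The $d$-defective density of $G$ is \[ \Gamma_d(G):=\max\left\{\left\lceil\frac{|E(G[X])|}{\lfloor d|X|/2\rfloor}\right\rceil : X\subseteq V(G),\ |X|>2\right\}, \] where $G[X]$ is the subgraph of $G$ induced by $X$ and $|E(G[X])|$ counts edges with multiplicity. *)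

theory Defs
  imports Complex_Main
begin

record ('v, 'e) pre_multigraph =
  verts :: "'v set"
  edges :: "'e set"
  ends :: "'e \<Rightarrow> 'v set"

text \<open>
  Edges are abstract objects carrying a set of end vertices, so parallel edges are distinct
  elements of \<open>edges G\<close> with the same \<open>ends\<close>. The condition \<open>card (ends G e) = 2\<close> excludes loops.
\<close>

locale multigraph =
  fixes G :: "('v, 'e) pre_multigraph"
  assumes finite_verts: "finite (verts G)"
    and finite_edges: "finite (edges G)"
    and ends_in_verts: "e \<in> edges G \<Longrightarrow> ends G e \<subseteq> verts G"
    and loopless: "e \<in> edges G \<Longrightarrow> card (ends G e) = 2"

definition degree :: "('v, 'e) pre_multigraph \<Rightarrow> 'v \<Rightarrow> nat" where
  "degree G v = card {e \<in> edges G. v \<in> ends G e}"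

text \<open>The inserted \<open>0\<close> only matters for the graph without vertices.\<close>

definition max_degree :: "('v, 'e) pre_multigraph \<Rightarrow> nat" where
  "max_degree G = Max (insert 0 (degree G ` verts G))"

definition induced_subgraph ::
  "('v, 'e) pre_multigraph \<Rightarrow> 'v set \<Rightarrow> ('v, 'e) pre_multigraph" where
  "induced_subgraph G X = G\<lparr>verts := X, edges := {e \<in> edges G. ends G e \<subseteq> X}\<rparr>"

definition edge_subgraph ::
  "('v, 'e) pre_multigraph \<Rightarrow> 'e set \<Rightarrow> ('v, 'e) pre_multigraph" where
  "edge_subgraph G F = G\<lparr>edges := F\<rparr>"

definition bipartite :: "('v, 'e) pre_multigraph \<Rightarrow> bool" where
  "bipartite G \<longleftrightarrow> (\<exists>A B. A \<union> B = verts G \<and> A \<inter> B = {} \<and>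
     (\<forall>e\<in>edges G. \<exists>a\<in>A. \<exists>b\<in>B. ends G e = {a, b}))"

text \<open>
  The cycle runs through the vertices \<open>vs ! 0, \<dots>, vs ! (n - 1)\<close> and back, where
  \<open>es ! i\<close> joins \<open>vs ! i\<close> to its cyclic successor. Two parallel edges form a cycle of length 2;
  distinctness of \<open>es\<close> prevents a single edge from being traversed back and forth.
\<close>

definition is_cycle :: "('v, 'e) pre_multigraph \<Rightarrow> 'v list \<Rightarrow> 'e list \<Rightarrow> bool" where
  "is_cycle G vs es \<longleftrightarrow>
     es \<noteq> [] \<and> length vs = length es \<and> distinct vs \<and> distinct es \<and>
     set vs \<subseteq> verts G \<and> set es \<subseteq> edges G \<and>
     (\<forall>i<length es. ends G (es ! i) = {vs ! i, vs ! (Suc i mod length es)})"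

text \<open>Meaningful for non-bipartite multigraphs only; otherwise there is no odd cycle.\<close>

definition odd_girth :: "('v, 'e) pre_multigraph \<Rightarrow> nat" where
  "odd_girth G = (LEAST n. odd n \<and> (\<exists>vs es. is_cycle G vs es \<and> length es = n))"

definition defective_edge_coloring ::
  "('v, 'e) pre_multigraph \<Rightarrow> nat \<Rightarrow> ('e \<Rightarrow> nat) \<Rightarrow> bool" where
  "defective_edge_coloring G d c \<longleftrightarrow>
     (\<forall>i. max_degree (edge_subgraph G {e \<in> edges G. c e = i}) \<le> d)"

definition defective_chromatic_index :: "('v, 'e) pre_multigraph \<Rightarrow> nat \<Rightarrow> nat" where
  "defective_chromatic_index G d =
     (LEAST k. \<exists>c. defective_edge_coloring G d c \<and> card (c ` edges G) \<le> k)"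

text \<open>Meaningful if \<open>d > 0\<close> and \<open>G\<close> has at least three vertices, as non-bipartite multigraphs do.\<close>

definition defective_density :: "('v, 'e) pre_multigraph \<Rightarrow> nat \<Rightarrow> int" where
  "defective_density G d =
     Max {\<lceil>real (card (edges (induced_subgraph G X))) / of_int \<lfloor>real (d * card X) / 2\<rfloor>\<rceil> | X.
            X \<subseteq> verts G \<and> card X > 2}"

end

theory Submission
  imports Defs
begin

text \<open>
  Put \<open>k = m + l\<close> and \<open>r = k d - \<Delta>(G) = l d - s\<close>. Color the edges one by one with \<open>k\<close> colors,
  and suppose that the last edge \<open>xy\<close> cannot be colored. A color \<open>a\<close> missing at \<open>x\<close> (of color degree
  below \<open>d\<close>) and a color \<open>b\<close> missing at \<open>y\<close> are then joined by an alternating trail from \<open>x\<close> to \<open>y\<close>,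
  and a missing color has color degree exactly \<open>d - 1\<close>. The trail and \<open>xy\<close> form an odd circuit, round
  which the uncolored edge can be rotated. As in Vizing's argument, different vertices of the circuit
  have no missing colors other than \<open>a\<close>, \<open>b\<close> in common, while each has at least \<open>r\<close> of them. The
  circuit contains an odd cycle \<open>C\<close>, so \<open>r |C| \<le> k - 2\<close>, contrary to the bound on the odd girth.
\<close>

section \<open>Chains of two involutions, and maximal pairings\<close>

text \<open>The orbit of \<open>p\<close> under \<open>\<tau> \<circ> \<sigma>\<close> is a cycle,
  and \<open>\<sigma>\<close> reverses it because \<open>\<tau>\<close> fixes \<open>p\<close>. The
  first half of the orbit is therefore a path whose far end, \<open>\<sigma> (f (n - 1))\<close>, is
  again fixed by \<open>\<tau>\<close>.\<close>

lemma involutions_chain: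
  fixes \<sigma> \<tau> :: "'a \<Rightarrow> 'a"
  assumes \<sigma>: "\<And>x. \<sigma> (\<sigma> x) = x" and \<tau>: "\<And>x. \<tau> (\<tau> x) = x"
    and D: "finite D" "\<And>x. x \<in> D \<Longrightarrow> \<sigma> x \<in> D" "\<And>x. x \<in> D \<Longrightarrow> \<tau> x \<in> D"
    and no_fix: "\<And>x. x \<in> D \<Longrightarrow> \<sigma> x \<noteq> x"
    and p: "p \<in> D" "\<tau> p = p"
  obtains n f where "0 < n" "f 0 = p" "\<And>i. f i \<in> D"
    "\<And>i. \<tau> (\<sigma> (f i)) = f (Suc i)" "\<tau> (\<sigma> (f (n - 1))) = \<sigma> (f (n - 1))"
    "inj_on f {..<n}" "\<And>i j. i < n \<Longrightarrow> j < n \<Longrightarrow> f i \<noteq> \<sigma> (f j)"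
proof -
  define q where "q = \<tau> \<circ> \<sigma>"
  define f where "f i = (q ^^ i) p" for i
  have f0: "f 0 = p" and fSuc: "f (Suc i) = q (f i)" for i by (simp_all add: f_def)
  have inj_q: "inj q" unfolding q_def by (metis \<sigma> \<tau> comp_apply injI)
  have fD: "f i \<in> D" for i
    by (induction i) (use p D in \<open>auto simp: f0 fSuc q_def\<close>)
  have "{y. \<exists>n. y = (q ^^ n) p} \<subseteq> D" using fD by (auto simp: f_def)
  then obtain N0 where "0 < N0" "f N0 = p"
    using funpow_inj_finite[OF inj_q] D(1) finite_subset f_def by metis
  define N where "N = (LEAST N. 0 < N \<and> f N = p)"
  have N: "0 < N" "f N = p"
    using LeastI[of "\<lambda>N. 0 < N \<and> f N = p" N0] \<open>0 < N0\<close> \<open>f N0 = p\<close> unfolding N_def by auto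
  have least: "\<not> (0 < i \<and> f i = p)" if "i < N" for i
    using not_less_Least[of i "\<lambda>N. 0 < N \<and> f N = p"] that unfolding N_def by auto
  have shift: "f i = f (i + t) \<Longrightarrow> f t = p" for i t
    by (induction i) (auto simp: f0 fSuc inj_eq[OF inj_q])
  have inj_f: "inj_on f {..<N}"
  proof (rule linorder_inj_onI)
    fix i j assume "i < j" "i \<in> {..<N}" "j \<in> {..<N}"
    then show "f i \<noteq> f j" using shift[of i "j - i"] least[of "j - i"] by auto
  qed auto
  have \<sigma>f: "i < N \<Longrightarrow> \<sigma> (f i) = f (N - Suc i)" for i
  proof (induction i)
    case 0
    \<comment> \<open>Both sides are \<open>p\<close>, by \<open>\<tau> p = p\<close> and by
      \<open>f N = p\<close>.\<close>
    have "q (\<sigma> (f 0)) = q (f (N - 1))"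
      using N fSuc[of "N - 1"] p by (simp add: q_def \<sigma> f0)
    then show ?case using inj_q by (simp add: inj_eq)
  next
    case (Suc i)
    have "q (\<sigma> (f (Suc i))) = \<sigma> (f i)" by (simp add: q_def \<sigma> \<tau> fSuc)
    also have "\<dots> = q (f (N - Suc (Suc i)))"
      using Suc fSuc[of "N - Suc (Suc i)"] by (simp add: Suc_diff_Suc)
    finally show ?case using inj_q by (simp add: inj_eq)
  qed
  \<comment> \<open>Since \<open>\<sigma>\<close> reverses the orbit of \<open>p\<close>, it would fix the middle of an orbit of odd length.\<close>
  have "even N"
  proof (rule ccontr)
    assume "odd N"
    then obtain h where "N = 2 * h + 1" by (elim oddE)
    then have "\<sigma> (f h) = f h" using \<sigma>f[of h] by simp
    then show False using no_fix fD by blast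
  qed
  then obtain n where n: "N = 2 * n" by (elim evenE)
  then have "0 < n" using N by auto
  show thesis
  proof (rule that[of n f])
    show "\<tau> (\<sigma> (f (n - 1))) = \<sigma> (f (n - 1))"
      using \<sigma>f[of "n - 1"] fSuc[of "n - 1"] \<open>0 < n\<close> n by (simp add: q_def Suc_diff_Suc mult_2)
    show "inj_on f {..<n}" by (rule inj_on_subset[OF inj_f]) (use n in auto)
    show "f i \<noteq> \<sigma> (f j)" if "i < n" "j < n" for i j
      using \<sigma>f[of j] inj_onD[OF inj_f, of i "N - Suc j"] that n by auto
  qed (use \<open>0 < n\<close> f0 fD fSuc q_def in auto)
qed

text \<open>The involution encodes a matching between \<open>A\<close> and \<open>B\<close> whose
  unmatched elements are its fixed points; the cardinality clauses make the matching exhaust the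
  smaller side.\<close>

definition is_pairing :: "('a \<Rightarrow> 'a) \<Rightarrow> 'a set \<Rightarrow> 'a set \<Rightarrow> bool" where
  "is_pairing t A B \<longleftrightarrow> (\<forall>x. t (t x) = x) \<and> (\<forall>x\<in>A. t x = x \<or> t x \<in> B) \<and> (\<forall>x\<in>B. t x = x \<or> t x \<in> A) \<and>
     (card A \<le> card B \<longrightarrow> (\<forall>x\<in>A. t x \<noteq> x)) \<and> (card B \<le> card A \<longrightarrow> (\<forall>x\<in>B. t x \<noteq> x))"

lemma is_pairing_commute: "is_pairing t A B \<Longrightarrow> is_pairing t B A"
  by (auto simp: is_pairing_def)

lemma pairing_exists:
  assumes "finite A" "finite B" "A \<inter> B = {}"
  shows "\<exists>t. is_pairing t A B"
proof -
  have le: "\<exists>t. is_pairing t A B"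
    if fin: "finite A" "finite B" and disj: "A \<inter> B = {}" and card: "card A \<le> card B" for A B :: "'a set"
  proof -
    obtain g where g: "g ` A \<subseteq> B" "inj_on g A" using card_le_inj[OF fin card] by blast
    define t where
      "t x = (if x \<in> A then g x else if x \<in> g ` A then inv_into A g x else x)" for x
    have gA: "g x \<in> B" "g x \<notin> A" if "x \<in> A" for x using g disj that by auto
    have surj: "t x \<noteq> x" if "card B \<le> card A" "x \<in> B" for x
    proof -
      have "g ` A = B" using g card that fin by (metis card_image card_subset_eq le_antisym)
      then show ?thesis using that disj by (auto simp: t_def inv_into_f_f[OF g(2)])
    qed
    have "is_pairing t A B"
      unfolding is_pairing_def
    proof (intro conjI allI ballI impI)
      show "t (t x) = x" for x
        by (auto simp: t_def gA inv_into_f_f[OF g(2)])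
      show "t x = x \<or> t x \<in> B" if "x \<in> A" for x using that gA by (auto simp: t_def)
      show "t x = x \<or> t x \<in> A" if "x \<in> B" for x
        using that disj by (auto simp: t_def inv_into_f_f[OF g(2)])
      show "t x \<noteq> x" if "x \<in> A" for x using that gA[of x] by (auto simp: t_def)
    qed (use surj in auto)
    then show ?thesis by blast
  qed
  show ?thesis
  proof (cases "card A \<le> card B")
    case True then show ?thesis using le assms by blast
  next
    case False
    then have "\<exists>t. is_pairing t B A" using le[of B A] assms by auto
    then show ?thesis using is_pairing_commute by blast
  qed
qed

text \<open>Inside \<open>S\<close>, \<open>t\<close> is a bijection between the moved elements of
  \<open>A\<close> and those of \<open>B\<close>, so the two sides differ only in their fixed
  points.\<close>

lemma pairing_card:
  assumes t: "is_pairing t A B" and fin: "finite A" "finite B" and disj: "A \<inter> B = {}"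
    and S: "\<And>x. x \<in> (A \<union> B) \<inter> S \<Longrightarrow> t x \<in> S"
  shows "card (B \<inter> S) + card {x \<in> A \<inter> S. t x = x} = card (A \<inter> S) + card {x \<in> B \<inter> S. t x = x}"
proof -
  have split: "card (C \<inter> S) = card {x \<in> C \<inter> S. t x = x} + card {x \<in> C \<inter> S. t x \<noteq> x}"
    if "finite C" for C
  proof -
    have "C \<inter> S \<inter> {x. t x = x} = {x \<in> C \<inter> S. t x = x}" "C \<inter> S - {x. t x = x} = {x \<in> C \<inter> S. t x \<noteq> x}"
      by auto
    then show ?thesis using card_Int_Diff[of "C \<inter> S" "{x. t x = x}"] that by simp
  qed
  have "bij_betw t {x \<in> A \<inter> S. t x \<noteq> x} {x \<in> B \<inter> S. t x \<noteq> x}"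
    by (rule bij_betw_byWitness[where f' = t])
      (use t S in \<open>fastforce simp: is_pairing_def\<close>)+
  then show ?thesis using split[OF fin(1)] split[OF fin(2)] bij_betw_same_card by force
qed

section \<open>Color degrees and color swaps\<close>

datatype ('e, 'v) dart = Dart (dart_edge: 'e) (dart_vertex: 'v)

definition swap_colors :: "nat \<Rightarrow> nat \<Rightarrow> 'e set \<Rightarrow> ('e \<Rightarrow> nat) \<Rightarrow> 'e \<Rightarrow> nat" where
  "swap_colors a b S c = (\<lambda>e. if e \<in> S \<and> c e = a then b else if e \<in> S \<and> c e = b then a else c e)"

text \<open>Vertices may repeat, because a color class may have degree above one. The trail opens
  with \<open>b\<close>, which in \<open>kempe_chain\<close> is the color in excess at its
  start.\<close>

definition alternating_trail ::
  "('v, 'e) pre_multigraph \<Rightarrow> ('e \<Rightarrow> nat) \<Rightarrow> nat \<Rightarrow> nat \<Rightarrow> (nat \<Rightarrow> 'v) \<Rightarrow> (nat \<Rightarrow> 'e) \<Rightarrow> nat \<Rightarrow> bool" where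
  "alternating_trail G c a b vs es n \<longleftrightarrow> 0 < n \<and> inj_on es {..<n} \<and>
     (\<forall>i<n. es i \<in> edges G \<and> ends G (es i) = {vs i, vs (Suc i)}) \<and>
     (\<forall>i<n. c (es i) = (if even i then b else a))"

definition color_degree :: "('v, 'e) pre_multigraph \<Rightarrow> ('e \<Rightarrow> nat) \<Rightarrow> 'v \<Rightarrow> nat \<Rightarrow> nat" where
  "color_degree G c v i = card {e \<in> edges G. v \<in> ends G e \<and> c e = i}"

definition bounded_coloring :: "('v, 'e) pre_multigraph \<Rightarrow> nat \<Rightarrow> nat \<Rightarrow> ('e \<Rightarrow> nat) \<Rightarrow> bool" where
  "bounded_coloring G d k c \<longleftrightarrow> (\<forall>e\<in>edges G. c e < k) \<and> (\<forall>v i. i < k \<longrightarrow> color_degree G c v i \<le> d)"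

context multigraph
begin

abbreviation cdeg :: "('e \<Rightarrow> nat) \<Rightarrow> 'v \<Rightarrow> nat \<Rightarrow> nat" where
  "cdeg \<equiv> color_degree G"

lemma degree_le_max_degree: "degree G v \<le> max_degree G"
proof (cases "v \<in> verts G")
  case True
  then show ?thesis using finite_verts by (auto simp: max_degree_def intro: Max_ge)
next
  case False
  then have "{e \<in> edges G. v \<in> ends G e} = {}" using ends_in_verts by blast
  then show ?thesis unfolding degree_def by (metis card.empty le0)
qed

lemma defective_chromatic_index_le:
  assumes c: "bounded_coloring G d k c"
  shows "defective_chromatic_index G d \<le> k"
proof -
  have "cdeg c v i \<le> d" for v i
  proof (cases "i < k")
    case False
    then have none: "{e \<in> edges G. v \<in> ends G e \<and> c e = i} = {}" using c by (auto simp: bounded_coloring_def)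
    show ?thesis unfolding color_degree_def none by simp
  qed (use c in \<open>simp add: bounded_coloring_def\<close>)
  moreover have "degree (edge_subgraph G {e \<in> edges G. c e = i}) v = cdeg c v i" for v i
    unfolding degree_def color_degree_def edge_subgraph_def
    by (intro arg_cong[where f = card]) auto
  ultimately have "defective_edge_coloring G d c"
    using finite_verts by (auto simp: defective_edge_coloring_def max_degree_def edge_subgraph_def)
  moreover have "card (c ` edges G) \<le> card {..<k}"
    using c by (intro card_mono) (auto simp: bounded_coloring_def)
  ultimately show ?thesis
    unfolding defective_chromatic_index_def by (intro Least_le) auto
qed

lemma multigraph_edge_subgraph: "F \<subseteq> edges G \<Longrightarrow> multigraph (edge_subgraph G F)"
  using finite_verts finite_edges ends_in_verts loopless
  by unfold_locales (auto simp: edge_subgraph_def intro: finite_subset)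

lemma other_end:
  assumes "e \<in> edges G" "v \<in> ends G e"
  obtains w where "w \<noteq> v" "ends G e = {v, w}"
proof -
  obtain u w where uw: "ends G e = {u, w}" "u \<noteq> w" using loopless[OF assms(1)] by (auto simp: card_2_iff)
  show thesis using assms(2) uw that[of u] that[of w] by auto
qed

text \<open>Sums on both sides avoid truncated subtraction: the parts of both color classes inside
  \<open>S\<close> change places.\<close>

lemma cdeg_swap_colors:
  fixes c :: "'e \<Rightarrow> nat"
  assumes "a \<noteq> b"
  defines "A w \<equiv> {e \<in> edges G. w \<in> ends G e \<and> c e = a}"
    and "B w \<equiv> {e \<in> edges G. w \<in> ends G e \<and> c e = b}"
  shows "cdeg (swap_colors a b S c) w a + card (A w \<inter> S) = cdeg c w a + card (B w \<inter> S)"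
    and "cdeg (swap_colors a b S c) w b + card (B w \<inter> S) = cdeg c w b + card (A w \<inter> S)"
    and "i \<noteq> a \<Longrightarrow> i \<noteq> b \<Longrightarrow> cdeg (swap_colors a b S c) w i = cdeg c w i"
proof -
  have fin: "finite (A w)" "finite (B w)" using finite_edges by (auto simp: A_def B_def)
  have "{e \<in> edges G. w \<in> ends G e \<and> swap_colors a b S c e = a} = (A w - S) \<union> (B w \<inter> S)"
    using assms(1) by (auto simp: swap_colors_def A_def B_def split: if_splits)
  then have "cdeg (swap_colors a b S c) w a = card (A w - S) + card (B w \<inter> S)"
    unfolding color_degree_def using fin by (subst card_Un_disjoint[symmetric]) auto
  moreover have "{e \<in> edges G. w \<in> ends G e \<and> swap_colors a b S c e = b} = (B w - S) \<union> (A w \<inter> S)"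
    using assms(1) by (auto simp: swap_colors_def A_def B_def split: if_splits)
  then have "cdeg (swap_colors a b S c) w b = card (B w - S) + card (A w \<inter> S)"
    unfolding color_degree_def using fin by (subst card_Un_disjoint[symmetric]) auto
  moreover have "cdeg c w a = card (A w - S) + card (A w \<inter> S)" "cdeg c w b = card (B w - S) + card (B w \<inter> S)"
    unfolding color_degree_def A_def[symmetric] B_def[symmetric]
    using card_Int_Diff[OF fin(1), of S] card_Int_Diff[OF fin(2), of S] by auto
  ultimately show "cdeg (swap_colors a b S c) w a + card (A w \<inter> S) = cdeg c w a + card (B w \<inter> S)"
    "cdeg (swap_colors a b S c) w b + card (B w \<inter> S) = cdeg c w b + card (A w \<inter> S)" by auto
  show "cdeg (swap_colors a b S c) w i = cdeg c w i" if "i \<noteq> a" "i \<noteq> b"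
    unfolding color_degree_def using that
    by (intro arg_cong[where f = card]) (auto simp: swap_colors_def)
qed

section \<open>Kempe chains\<close>

text \<open>At each vertex, edges of color \<open>a\<close> are paired with edges of color \<open>b\<close>, as many as possible.
  The chain starts with an unpaired edge and follows the pairing; in terms of darts (incident pairs of
  an edge and a vertex) it alternates between the reversal \<open>\<sigma>\<close> of a dart and the pairing \<open>\<tau>\<close>.\<close>

lemma kempe_chain:
  assumes ab: "a \<noteq> b" and v: "cdeg c v a < cdeg c v b"
  obtains n vs es c' where
    "alternating_trail G c a b vs es n" "vs 0 = v" "c' = swap_colors a b (es ` {..<n}) c"
    "\<And>w i. w \<noteq> v \<Longrightarrow> w \<noteq> vs n \<Longrightarrow> cdeg c' w i = cdeg c w i"
    "\<And>w i. i \<noteq> a \<Longrightarrow> i \<noteq> b \<Longrightarrow> cdeg c' w i = cdeg c w i"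
    "\<And>w. cdeg c' w a \<le> max (cdeg c w a) (cdeg c w b)"
    "\<And>w. cdeg c' w b \<le> max (cdeg c w a) (cdeg c w b)"
    "cdeg c' v b < cdeg c v b"
    "vs n \<noteq> v \<Longrightarrow> cdeg c' v a = cdeg c v a + 1"
    "vs n \<noteq> v \<Longrightarrow> cdeg c (vs n) a < cdeg c (vs n) b \<and> odd n \<and>
         cdeg c' (vs n) a = cdeg c (vs n) a + 1 \<and> cdeg c' (vs n) b + 1 = cdeg c (vs n) b \<or>
       cdeg c (vs n) b < cdeg c (vs n) a \<and> even n \<and>
         cdeg c' (vs n) b = cdeg c (vs n) b + 1 \<and> cdeg c' (vs n) a + 1 = cdeg c (vs n) a"
proof -
  define A where "A w = {e \<in> edges G. w \<in> ends G e \<and> c e = a}" for w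
  define B where "B w = {e \<in> edges G. w \<in> ends G e \<and> c e = b}" for w
  have fin: "finite (A w)" "finite (B w)" for w using finite_edges by (auto simp: A_def B_def)
  have disj: "A w \<inter> B w = {}" for w using ab by (auto simp: A_def B_def)
  have cardA: "card (A w) = cdeg c w a" and cardB: "card (B w) = cdeg c w b" for w
    by (simp_all add: color_degree_def A_def B_def)
  define t where "t w = (SOME t. is_pairing t (A w) (B w))" for w
  have t: "is_pairing (t w) (A w) (B w)" for w
    unfolding t_def using someI_ex[OF pairing_exists[OF fin disj]] .
  have tt: "t w (t w e) = e" for w e using t by (auto simp: is_pairing_def)
  define D where "D = {Dart e w | e w. e \<in> A w \<union> B w}"
  define opp where "opp e w = the_elem (ends G e - {w})" for e w
  have opp: "opp e w \<noteq> w" "ends G e = {w, opp e w}" "opp e (opp e w) = w"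
    if "Dart e w \<in> D" for e w
  proof -
    have "e \<in> edges G" "w \<in> ends G e" using that by (auto simp: D_def A_def B_def)
    then obtain u where u: "u \<noteq> w" "ends G e = {w, u}" by (elim other_end)
    then have "opp e w = u" "opp e u = w" by (auto simp: opp_def insert_Diff_if)
    then show "opp e w \<noteq> w" "ends G e = {w, opp e w}" "opp e (opp e w) = w" using u by auto
  qed
  \<comment> \<open>Outside \<open>D\<close> the map is the identity, which keeps it an involution
    on all darts.\<close>
  define \<sigma> where "\<sigma> x = (if x \<in> D then Dart (dart_edge x) (opp (dart_edge x) (dart_vertex x)) else x)" for x
  define \<tau> where "\<tau> x = Dart (t (dart_vertex x) (dart_edge x)) (dart_vertex x)" for x
  have DD: "Dart e w \<in> D \<longleftrightarrow> e \<in> edges G \<and> w \<in> ends G e \<and> (c e = a \<or> c e = b)" for e w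
    by (auto simp: D_def A_def B_def)
  have \<sigma>D: "\<sigma> x \<in> D" if "x \<in> D" for x
    using that opp[of "dart_edge x" "dart_vertex x"] by (cases x) (auto simp: \<sigma>_def DD)
  have \<tau>D: "\<tau> x \<in> D" if "x \<in> D" for x
    using that t[of "dart_vertex x"] by (cases x) (auto simp: D_def \<tau>_def is_pairing_def)
  have "D \<subseteq> (\<lambda>(e, w). Dart e w) ` (edges G \<times> verts G)"
    using ends_in_verts by (fastforce simp: D_def A_def B_def)
  then have finD: "finite D" using finite_edges finite_verts finite_subset by blast
  have \<sigma>\<sigma>: "\<sigma> (\<sigma> x) = x" for x
    using \<sigma>D[of x] opp[of "dart_edge x" "dart_vertex x"] by (cases x) (auto simp: \<sigma>_def)
  have \<tau>\<tau>: "\<tau> (\<tau> x) = x" for x by (simp add: \<tau>_def tt)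
  have fixA: "{e \<in> A w. t w e = e} = {}" if "cdeg c w a \<le> cdeg c w b" for w
    using that t[of w] by (auto simp: is_pairing_def cardA cardB)
  have fixB: "{e \<in> B w. t w e = e} = {}" if "cdeg c w b \<le> cdeg c w a" for w
    using that t[of w] by (auto simp: is_pairing_def cardA cardB)
  have total: "cdeg c w b + card {e \<in> A w. t w e = e} = cdeg c w a + card {e \<in> B w. t w e = e}" for w
    using pairing_card[OF t fin disj, where S = UNIV] by (simp add: cardA cardB)
  \<comment> \<open>Color \<open>b\<close> exceeds \<open>a\<close> at \<open>v\<close>, so some
    edge of color \<open>b\<close> is unpaired there; its dart is the fixed point of
    \<open>\<tau>\<close> from which the chain starts.\<close>
  have "card {e \<in> B v. t v e = e} \<noteq> 0" using total[of v] v by linarith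
  then obtain f where f: "f \<in> B v" "t v f = f" by (metis (mono_tags, lifting) card.empty empty_Collect_eq)
  have p: "Dart f v \<in> D" "\<tau> (Dart f v) = Dart f v" using f by (auto simp: D_def \<tau>_def)
  have no_fix: "\<sigma> x \<noteq> x" if "x \<in> D" for x
    using that opp[of "dart_edge x" "dart_vertex x"] by (cases x) (auto simp: \<sigma>_def)
  obtain n g where n: "0 < n" and g0: "g 0 = Dart f v" and gD: "\<And>i. g i \<in> D"
    and gSuc: "\<And>i. \<tau> (\<sigma> (g i)) = g (Suc i)" and gend: "\<tau> (\<sigma> (g (n - 1))) = \<sigma> (g (n - 1))"
    and ginj: "inj_on g {..<n}" and gdisj: "\<And>i j. i < n \<Longrightarrow> j < n \<Longrightarrow> g i \<noteq> \<sigma> (g j)"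
    by (rule involutions_chain[where \<sigma> = \<sigma> and \<tau> = \<tau> and D = D, OF \<sigma>\<sigma> \<tau>\<tau> finD _ _ _ p])
      (erule \<sigma>D | erule \<tau>D | erule no_fix | rule that; assumption)+
  define es where "es i = dart_edge (g i)" for i
  define vs where "vs i = dart_vertex (g i)" for i
  have g: "g i = Dart (es i) (vs i)" for i by (simp add: es_def vs_def)
  have \<sigma>g: "\<sigma> (g i) = Dart (es i) (opp (es i) (vs i))" for i using gD by (simp add: \<sigma>_def g)
  have vsSuc: "vs (Suc i) = opp (es i) (vs i)" for i
    using gSuc[of i] unfolding \<sigma>g by (simp add: \<tau>_def g)
  have \<sigma>g': "\<sigma> (g i) = Dart (es i) (vs (Suc i))" "\<sigma> (Dart (es i) (vs i)) = Dart (es i) (vs (Suc i))" for i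
    using \<sigma>g[of i] by (simp_all add: vsSuc flip: g)
  have ends_es: "ends G (es i) = {vs i, vs (Suc i)}" for i
    using opp(2)[of "es i" "vs i"] gD[of i] by (simp add: vsSuc g)
  have tes: "t (vs (Suc i)) (es i) = es (Suc i)" for i using gSuc[of i] unfolding \<sigma>g' by (simp add: \<tau>_def g)
  have tes': "t (vs (Suc i)) (es (Suc i)) = es i" for i using tes tt by metis
  \<comment> \<open>An edge has only two darts, so those of the trail edge \<open>es i\<close> are
    \<open>g i\<close> and its reversal.\<close>
  have darts: "(\<exists>i<n. x = g i \<or> x = \<sigma> (g i))" if "x \<in> D" "dart_edge x \<in> es ` {..<n}" for x
  proof -
    from that(2) obtain i where i: "i < n" "dart_edge x = es i" by auto
    then have "dart_vertex x = vs i \<or> dart_vertex x = vs (Suc i)" using that(1) ends_es[of i] by (cases x) (auto simp: DD)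
    then have "x = g i \<or> x = \<sigma> (g i)" using i(2) by (cases x) (auto simp: g \<sigma>g')
    then show ?thesis using i(1) by blast
  qed
  have inj_es: "inj_on es {..<n}"
  proof (rule inj_onI)
    fix i j assume ij: "i \<in> {..<n}" "j \<in> {..<n}" "es i = es j"
    then have "vs i = vs j \<or> vs i = vs (Suc j)" using ends_es[of i] ends_es[of j] by auto
    then have "g i = g j \<or> g i = \<sigma> (g j)" using ij by (auto simp: g \<sigma>g')
    then show "i = j" using ij gdisj ginj by (auto dest: inj_onD)
  qed
  define S where "S = es ` {..<n}"
  \<comment> \<open>No pair leaves the trail: consecutive edges are paired, and the two end darts
    are fixed.\<close>
  have tS: "t w e \<in> S" if "e \<in> (A w \<union> B w) \<inter> S" for w e
  proof -
    have "Dart e w \<in> D" "dart_edge (Dart e w) \<in> es ` {..<n}" using that by (auto simp: D_def S_def)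
    from darts[OF this] obtain i where i: "i < n" "Dart e w = g i \<or> Dart e w = \<sigma> (g i)" by blast
    show ?thesis
    proof (cases "Dart e w = g i")
      case True
      then show ?thesis using i f g0 tes'[of "i - 1"] that
        by (cases i) (auto simp: g S_def)
    next
      case False
      then have e: "e = es i" "w = vs (Suc i)" using i by (auto simp: \<sigma>g')
      show ?thesis
      proof (cases "Suc i = n")
        case True
        then show ?thesis using gend that e by (auto simp: \<tau>_def \<sigma>g')
      next
        case False
        then show ?thesis using tes[of i] e i by (auto simp: S_def)
      qed
    qed
  qed
  \<comment> \<open>Unpaired incidences occur only at the two ends of the trail, since elsewhere
    \<open>\<tau>\<close> leads to a neighboring edge of the trail, and trail edges are
    distinct.\<close>
  have fixed: "(e = f \<and> w = v) \<or> (e = es (n - 1) \<and> w = vs n)"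
    if "e \<in> (A w \<union> B w) \<inter> S" "t w e = e" for w e
  proof -
    have "Dart e w \<in> D" "dart_edge (Dart e w) \<in> es ` {..<n}" using that by (auto simp: D_def S_def)
    from darts[OF this] obtain i where i: "i < n" "Dart e w = g i \<or> Dart e w = \<sigma> (g i)" by blast
    show ?thesis
    proof (cases "Dart e w = g i")
      case True
      show ?thesis
      proof (cases i)
        case 0 then show ?thesis using True g0 by auto
      next
        case (Suc j)
        then have "es i = es j" using True tes'[of j] that by (auto simp: g)
        then show ?thesis using Suc i inj_es by (auto dest: inj_onD)
      qed
    next
      case False
      then have e: "e = es i" "w = vs (Suc i)" using i by (auto simp: \<sigma>g')
      show ?thesis
      proof (cases "Suc i = n")
        case True
        then show ?thesis using e by auto
      next
        case False
        then have "es (Suc i) = es i" using tes[of i] e that by auto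
        then show ?thesis using False i inj_es by (auto dest: inj_onD)
      qed
    qed
  qed
  have col: "c (es i) = (if even i then b else a)" if "i < n" for i
    using that
  proof (induction i)
    case 0
    then show ?case using f g0 by (simp add: g B_def)
  next
    case (Suc i)
    have "es (Suc i) \<noteq> es i" using inj_es Suc.prems by (auto dest: inj_onD)
    moreover have "Dart (es i) (vs (Suc i)) \<in> D" using gD \<sigma>D \<sigma>g' by metis
    ultimately have "es i \<in> A (vs (Suc i)) \<and> es (Suc i) \<in> B (vs (Suc i)) \<or>
        es i \<in> B (vs (Suc i)) \<and> es (Suc i) \<in> A (vs (Suc i))"
      using t[of "vs (Suc i)"] tes[of i] by (auto simp: is_pairing_def D_def)
    then show ?case using Suc ab by (auto simp: A_def B_def)
  qed
  have trail: "alternating_trail G c a b vs es n"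
    using n inj_es ends_es col gD DD by (auto simp: alternating_trail_def g)
  define c' where "c' = swap_colors a b S c"
  \<comment> \<open>Paired trail edges exchange their colors at \<open>w\<close> without effect on
    the color degrees, so only the unpaired ones collected in \<open>FA w\<close> and
    \<open>FB w\<close> count.\<close>
  define FA where "FA w = {e \<in> A w \<inter> S. t w e = e}" for w
  define FB where "FB w = {e \<in> B w \<inter> S. t w e = e}" for w
  have finF: "finite (FA w)" "finite (FB w)" for w using fin by (auto simp: FA_def FB_def)
  have FA_le: "card (FA w) \<le> card {e \<in> A w. t w e = e}"
    and FB_le: "card (FB w) \<le> card {e \<in> B w. t w e = e}" for w
    using fin by (auto simp: FA_def FB_def intro!: card_mono)
  have cnt: "card (B w \<inter> S) + card (FA w) = card (A w \<inter> S) + card (FB w)" for w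
    unfolding FA_def FB_def by (rule pairing_card[OF t fin disj tS])
  have ca: "cdeg c' w a + card (FA w) = cdeg c w a + card (FB w)"
    and cb: "cdeg c' w b + card (FB w) = cdeg c w b + card (FA w)" for w
    using cdeg_swap_colors(1,2)[OF ab, of S c w] cnt[of w] by (auto simp: c'_def A_def B_def)
  have co: "cdeg c' w i = cdeg c w i" if "i \<noteq> a" "i \<noteq> b" for w i
    using cdeg_swap_colors(3)[OF ab that] by (simp add: c'_def)
  have fS: "f \<in> S" using n g0 by (auto simp: S_def g)
  have fFB: "f \<in> FB v" using f fS by (auto simp: FB_def)
  have FAv: "FA v = {}" using fixA[of v] v by (auto simp: FA_def)
  show thesis
  proof (rule that[OF trail, of c'])
    show "vs 0 = v" using g0 by (simp add: g)
    show "c' = swap_colors a b (es ` {..<n}) c" by (simp add: c'_def S_def)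
    show "cdeg c' w i = cdeg c w i" if "w \<noteq> v" "w \<noteq> vs n" for w i
    proof -
      have "FA w = {}" "FB w = {}" using fixed[of _ w] that by (auto simp: FA_def FB_def)
      then show ?thesis using ca[of w] cb[of w] co by (cases "i = a"; cases "i = b") auto
    qed
    show "cdeg c' w a \<le> max (cdeg c w a) (cdeg c w b)" "cdeg c' w b \<le> max (cdeg c w a) (cdeg c w b)" for w
    proof -
      \<comment> \<open>Only the color with more edges at \<open>w\<close> can have unpaired ones,
        and their number is the difference of the two degrees; so a swap cannot exceed the larger
        degree.\<close>
      have "card {e \<in> A w. t w e = e} = 0 \<and> cdeg c w a \<le> cdeg c w b \<or>
          card {e \<in> B w. t w e = e} = 0 \<and> cdeg c w b \<le> cdeg c w a"
        using linear[of "cdeg c w a" "cdeg c w b"] by (elim disjE) (simp_all only: fixA fixB card.empty simp_thms)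
      then show "cdeg c' w a \<le> max (cdeg c w a) (cdeg c w b)" "cdeg c' w b \<le> max (cdeg c w a) (cdeg c w b)"
        using ca[of w] cb[of w] FA_le[of w] FB_le[of w] total[of w] by linarith+
    qed
    have "card (FB v) > 0" using fFB finF by (auto simp: card_gt_0_iff)
    then show "cdeg c' v b < cdeg c v b" using cb[of v] FAv by simp
    \<comment> \<open>If the trail returned to \<open>v\<close>, both of its end edges would be
      unpaired there and \<open>a\<close> would gain two.\<close>
    assume z: "vs n \<noteq> v"
    have "FB v = {f}" using fFB fixed[of _ v] z by (auto simp: FB_def)
    then show "cdeg c' v a = cdeg c v a + 1" using ca[of v] FAv by simp
    \<comment> \<open>The parity of \<open>n\<close> tells the color of the last edge, and hence
      which of the two colors is in excess at \<open>vs n\<close>.\<close>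
    define h where "h = es (n - 1)"
    have h: "h \<in> S" "t (vs n) h = h" "Dart h (vs n) \<in> D" "c h = (if even (n - 1) then b else a)"
      using n gend col[of "n - 1"] \<sigma>D[OF gD, of "n - 1"] by (auto simp: S_def h_def \<tau>_def \<sigma>g')
    have F: "FA (vs n) \<subseteq> {h}" "FB (vs n) \<subseteq> {h}"
      using fixed[of _ "vs n"] z by (auto simp: FA_def FB_def h_def)
    show "cdeg c (vs n) a < cdeg c (vs n) b \<and> odd n \<and>
         cdeg c' (vs n) a = cdeg c (vs n) a + 1 \<and> cdeg c' (vs n) b + 1 = cdeg c (vs n) b \<or>
       cdeg c (vs n) b < cdeg c (vs n) a \<and> even n \<and>
         cdeg c' (vs n) b = cdeg c (vs n) b + 1 \<and> cdeg c' (vs n) a + 1 = cdeg c (vs n) a"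
    proof (cases "odd n")
      case True
      then have hB: "h \<in> B (vs n)" "h \<notin> A (vs n)" using h n ab by (auto simp: DD B_def A_def)
      then have "FB (vs n) = {h}" "FA (vs n) = {}" using F h by (auto simp: FA_def FB_def)
      moreover have "cdeg c (vs n) a < cdeg c (vs n) b"
        using fixB[of "vs n"] hB h by fastforce
      ultimately show ?thesis using True ca[of "vs n"] cb[of "vs n"] by simp
    next
      case False
      then have hA: "h \<in> A (vs n)" "h \<notin> B (vs n)" using h n ab by (auto simp: DD B_def A_def)
      then have "FA (vs n) = {h}" "FB (vs n) = {}" using F h by (auto simp: FA_def FB_def)
      moreover have "cdeg c (vs n) b < cdeg c (vs n) a"
        using fixA[of "vs n"] hA h by fastforce
      ultimately show ?thesis using False ca[of "vs n"] cb[of "vs n"] by simp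
    qed
  qed (use co in auto)
qed

lemma cdeg_upd:
  assumes "e \<in> edges G"
  shows "cdeg (c(e := i)) v j + of_bool (v \<in> ends G e \<and> c e = j) =
    cdeg c v j + of_bool (v \<in> ends G e \<and> i = j)"
proof -
  define F where "F = {f \<in> edges G - {e}. v \<in> ends G f \<and> c f = j}"
  have F: "finite F" "e \<notin> F" using finite_edges by (auto simp: F_def)
  have "{f \<in> edges G. v \<in> ends G f \<and> c f = j} = (if v \<in> ends G e \<and> c e = j then insert e F else F)"
    using assms by (auto simp: F_def)
  moreover have "{f \<in> edges G. v \<in> ends G f \<and> (c(e := i)) f = j} =
      (if v \<in> ends G e \<and> i = j then insert e F else F)"
    using assms by (auto simp: F_def)
  ultimately show ?thesis using F by (auto simp: color_degree_def)
qed

lemma degree_eq_sum_cdeg: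
  assumes "\<And>e. e \<in> edges G \<Longrightarrow> c e \<le> k"
  shows "(\<Sum>i\<le>k. cdeg c v i) = degree G v"
proof -
  define F where "F = {e \<in> edges G. v \<in> ends G e}"
  have "(\<Sum>i\<le>k. \<Sum>e\<in>{e \<in> F. c e = i}. 1) = (\<Sum>e\<in>F. 1::nat)"
    by (rule sum.group) (use finite_edges assms in \<open>auto simp: F_def\<close>)
  then show ?thesis by (simp add: F_def color_degree_def degree_def conj_assoc)
qed

section \<open>Odd cycles in odd closed trails\<close>

text \<open>A repeated vertex splits the closed trail into two shorter ones. Their lengths add up to
  the odd \<open>n\<close>, so one of them is odd and the induction continues with it.\<close>

lemma odd_closed_trail_contains_cycle:
  assumes "odd n" "inj_on es {..<n}" "vs n = vs 0"
    and "\<And>i. i < n \<Longrightarrow> es i \<in> edges G \<and> ends G (es i) = {vs i, vs (Suc i)}"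
  shows "\<exists>cvs ces. is_cycle G cvs ces \<and> odd (length ces) \<and> set cvs \<subseteq> vs ` {..<n}"
  using assms
proof (induction n arbitrary: vs es rule: less_induct)
  case (less n)
  have n: "0 < n" using less.prems(1) by (cases n) auto
  show ?case
  proof (cases "inj_on vs {..<n}")
    case True
    have "ends G (es i) = {vs i, vs (Suc i mod n)}" if "i < n" for i
      using less.prems(3,4) that by (cases "Suc i = n") (auto simp: mod_less)
    moreover have "vs i \<in> verts G" if "i < n" for i
      using less.prems(4)[OF that] ends_in_verts by blast
    ultimately have "is_cycle G (map vs [0..<n]) (map es [0..<n])"
      unfolding is_cycle_def using less.prems n True by (auto simp: distinct_map lessThan_atLeast0)
    then show ?thesis using less.prems(1) by (intro exI conjI) auto
  next
    case False
    have "\<exists>i j. i < j \<and> j < n \<and> vs i = vs j"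
      by (rule ccontr, rule notE[OF False], rule linorder_inj_onI') auto
    then obtain i j where ij: "i < j" "j < n" "vs i = vs j" by blast
    show ?thesis
    proof (cases "odd (j - i)")
      case True
      have "\<exists>cvs ces. is_cycle G cvs ces \<and> odd (length ces) \<and> set cvs \<subseteq> (\<lambda>t. vs (i + t)) ` {..<j - i}"
      proof (rule less.IH[of "j - i" "\<lambda>t. es (i + t)"])
        show "inj_on (\<lambda>t. es (i + t)) {..<j - i}"
          using ij by (auto intro!: inj_onI dest!: inj_onD[OF less.prems(2)])
      qed (use True ij less.prems(4) in auto)
      moreover have "(\<lambda>t. vs (i + t)) ` {..<j - i} \<subseteq> vs ` {..<n}" using ij by auto
      ultimately show ?thesis by (elim exE conjE) (intro exI conjI, assumption, assumption, erule order_trans)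
    next
      case False
      \<comment> \<open>The stretch from \<open>i\<close> to \<open>j\<close> is even and is cut
        out; \<open>vs i = vs j\<close> joins what remains.\<close>
      define vs' where "vs' t = (if t \<le> i then vs t else vs (t + (j - i)))" for t
      define es' where "es' t = (if t < i then es t else es (t + (j - i)))" for t
      have "\<exists>cvs ces. is_cycle G cvs ces \<and> odd (length ces) \<and> set cvs \<subseteq> vs' ` {..<n - (j - i)}"
      proof (rule less.IH[of "n - (j - i)" es'])
        show "inj_on es' {..<n - (j - i)}"
        proof (rule linorder_inj_onI')
          fix u v assume uv: "u \<in> {..<n - (j - i)}" "v \<in> {..<n - (j - i)}" "u < v"
          have "(if u < i then u else u + (j - i)) \<noteq> (if v < i then v else v + (j - i))" using uv(3) by simp
          then show "es' u \<noteq> es' v"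
            unfolding es'_def if_distrib[of es, symmetric] using uv ij by (subst inj_on_eq_iff[OF less.prems(2)]) auto
        qed
        show "vs' (n - (j - i)) = vs' 0" using ij less.prems(3) by (simp add: vs'_def)
        show "es' t \<in> edges G \<and> ends G (es' t) = {vs' t, vs' (Suc t)}" if "t < n - (j - i)" for t
          using ij that less.prems(4)[of t] less.prems(4)[of "t + (j - i)"]
          by (cases "t = i") (auto simp: vs'_def es'_def)
      qed (use False ij less.prems(1) in auto)
      moreover have "vs' ` {..<n - (j - i)} \<subseteq> vs ` {..<n}" using ij by (auto simp: vs'_def)
      ultimately show ?thesis by (elim exE conjE) (intro exI conjI, assumption, assumption, erule order_trans)
    qed
  qed
qed

end

section \<open>Kempe swaps around the last uncolored edge\<close>

text \<open>The extra color \<open>k\<close> marks the single edge that is still uncolored.\<close>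

definition near_coloring :: "('v, 'e) pre_multigraph \<Rightarrow> nat \<Rightarrow> nat \<Rightarrow> ('e \<Rightarrow> nat) \<Rightarrow> 'e \<Rightarrow> bool" where
  "near_coloring G d k c e0 \<longleftrightarrow> e0 \<in> edges G \<and> c e0 = k \<and> (\<forall>e\<in>edges G - {e0}. c e < k) \<and>
     (\<forall>v i. i < k \<longrightarrow> color_degree G c v i \<le> d)"

text \<open>\<open>r\<close> is spare capacity that \<open>k\<close> colors of capacity
  \<open>d\<close> leave at each vertex. This is the setting for the contradiction: a near coloring
  can never be completed, even after Kempe swaps.\<close>

locale uncolorable = multigraph G for G :: "('v, 'e) pre_multigraph" +
  fixes d k r :: nat
  assumes degree_bound: "degree G v + r \<le> k * d"
    and r_pos: "0 < r"
    and not_colorable: "\<not> bounded_coloring G d k c"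
begin

text \<open>A color with room at both ends could be given to \<open>e0\<close>.\<close>

lemma missing_disjoint:
  assumes c: "near_coloring G d k c e0" and xy: "ends G e0 = {x, y}" and "a < k"
    and "cdeg c x a < d" "cdeg c y a < d"
  shows False
proof -
  have e0: "e0 \<in> edges G" "c e0 = k" using c by (auto simp: near_coloring_def)
  have "cdeg (c(e0 := a)) v i \<le> d" if "i < k" for v i
  proof -
    have "cdeg (c(e0 := a)) v i = cdeg c v i + of_bool (v \<in> {x, y} \<and> a = i)"
      using cdeg_upd[OF e0(1), of c a v i] e0(2) that xy by simp
    moreover have "cdeg c v i \<le> d" using c that by (auto simp: near_coloring_def)
    ultimately show ?thesis using assms(4,5) by (auto simp: of_bool_def)
  qed
  then have "bounded_coloring G d k (c(e0 := a))"
    using c \<open>a < k\<close> by (auto simp: bounded_coloring_def near_coloring_def)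
  then show False using not_colorable by blast
qed

text \<open>The uncolored edge counts towards the degree of \<open>x\<close> but uses none of the
  colors below \<open>k\<close>, which yields one unit beyond \<open>r\<close>.\<close>

lemma near_coloring_slack:
  assumes c: "near_coloring G d k c e0" and "x \<in> ends G e0"
  shows "Suc r \<le> (\<Sum>i<k. d - cdeg c x i)"
proof -
  have "(\<Sum>i\<le>k. cdeg c x i) = degree G x"
    by (rule degree_eq_sum_cdeg) (use c in \<open>auto simp: near_coloring_def dest: order.strict_implies_order\<close>)
  then have "(\<Sum>i<k. cdeg c x i) + cdeg c x k + r \<le> k * d"
    using degree_bound[of x] by (simp add: lessThan_Suc_atMost[symmetric])
  moreover have "e0 \<in> {e \<in> edges G. x \<in> ends G e \<and> c e = k}"
    using assms by (auto simp: near_coloring_def)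
  then have "0 < cdeg c x k" unfolding color_degree_def using finite_edges by (auto simp: card_gt_0_iff)
  moreover have "(\<Sum>i<k. d - cdeg c x i) + (\<Sum>i<k. cdeg c x i) = (\<Sum>i<k. d)"
    unfolding sum.distrib[symmetric]
    by (rule sum.cong) (use c in \<open>auto simp: near_coloring_def\<close>)
  ultimately show ?thesis by simp
qed

lemma near_coloring_missing:
  assumes "near_coloring G d k c e0" "x \<in> ends G e0"
  obtains a where "a < k" "cdeg c x a < d"
proof -
  have "(\<Sum>i<k. d - cdeg c x i) \<noteq> 0" using near_coloring_slack[OF assms] by linarith
  then show thesis using that by (auto simp: sum_eq_0_iff)
qed

lemma near_coloring_swap:
  assumes c: "near_coloring G d k c e0" and "a < k" "b < k"
    and "\<And>w. cdeg (swap_colors a b S c) w a \<le> max (cdeg c w a) (cdeg c w b)"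
    and "\<And>w. cdeg (swap_colors a b S c) w b \<le> max (cdeg c w a) (cdeg c w b)"
    and "\<And>w i. i \<noteq> a \<Longrightarrow> i \<noteq> b \<Longrightarrow> cdeg (swap_colors a b S c) w i = cdeg c w i"
  shows "near_coloring G d k (swap_colors a b S c) e0"
proof -
  have bound: "cdeg c w i \<le> d" if "i < k" for w i using c that by (auto simp: near_coloring_def)
  have "cdeg (swap_colors a b S c) w i \<le> d" if "i < k" for w i
  proof -
    have "max (cdeg c w a) (cdeg c w b) \<le> d" using bound assms(2,3) by simp
    then show ?thesis using assms(4)[of w] assms(5)[of w] assms(6)[of i w] bound[OF that, of w]
      by (metis order_trans)
  qed
  then show ?thesis using c assms(2,3) by (auto simp: near_coloring_def swap_colors_def)
qed

text \<open>Swapping the chain from \<open>x\<close> would free \<open>b\<close> at both ends of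
  \<open>e0\<close> unless the chain stops at \<open>y\<close>.\<close>

lemma kempe_closes:
  assumes c: "near_coloring G d k c e0" and xy: "ends G e0 = {x, y}"
    and a: "a < k" "cdeg c x a < d" and b: "b < k" "cdeg c y b < d"
  shows "d \<le> cdeg c x a + 1 \<and>
    (\<exists>n vs es. alternating_trail G c a b vs es n \<and> vs 0 = x \<and> vs n = y \<and> even n)"
proof -
  have "e0 \<in> edges G" using c by (auto simp: near_coloring_def)
  then have "x \<noteq> y" using loopless xy by fastforce
  have bound: "cdeg c u i \<le> d" if "i < k" for u i using c that by (auto simp: near_coloring_def)
  have "\<not> cdeg c x b < d" "\<not> cdeg c y a < d"
    using a b missing_disjoint[OF c xy] by blast+
  then have full: "cdeg c x b = d" "cdeg c y a = d"
    using bound[OF b(1), of x] bound[OF a(1), of y] by auto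
  then have "a \<noteq> b" "cdeg c x a < cdeg c x b" using a b by auto
  then obtain n vs es c' where
    trail: "alternating_trail G c a b vs es n" "vs 0 = x" and c': "c' = swap_colors a b (es ` {..<n}) c"
    and away: "\<And>w i. w \<noteq> x \<Longrightarrow> w \<noteq> vs n \<Longrightarrow> cdeg c' w i = cdeg c w i"
    and other: "\<And>w i. i \<noteq> a \<Longrightarrow> i \<noteq> b \<Longrightarrow> cdeg c' w i = cdeg c w i"
    and le: "\<And>w. cdeg c' w a \<le> max (cdeg c w a) (cdeg c w b)"
      "\<And>w. cdeg c' w b \<le> max (cdeg c w a) (cdeg c w b)"
    and x: "cdeg c' x b < cdeg c x b" "vs n \<noteq> x \<Longrightarrow> cdeg c' x a = cdeg c x a + 1"
    and z: "vs n \<noteq> x \<Longrightarrow> cdeg c (vs n) a < cdeg c (vs n) b \<and> odd n \<and>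
         cdeg c' (vs n) a = cdeg c (vs n) a + 1 \<and> cdeg c' (vs n) b + 1 = cdeg c (vs n) b \<or>
       cdeg c (vs n) b < cdeg c (vs n) a \<and> even n \<and>
         cdeg c' (vs n) b = cdeg c (vs n) b + 1 \<and> cdeg c' (vs n) a + 1 = cdeg c (vs n) a"
    by (rule kempe_chain) (rule that)
  have nc': "near_coloring G d k c' e0"
    unfolding c' by (rule near_coloring_swap[OF c a(1) b(1)]) (use le other c' in auto)
  have vsn: "vs n = y"
  proof (rule ccontr)
    assume "vs n \<noteq> y"
    then show False
      using missing_disjoint[OF nc' xy b(1)] away[of y b] x(1) full b \<open>x \<noteq> y\<close> by simp
  qed
  \<comment> \<open>At \<open>y\<close> color \<open>a\<close> is full and \<open>b\<close> is not,
    so the chain arrives by an edge of color \<open>a\<close>; this makes \<open>n\<close> even, and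
    the swap frees \<open>a\<close> at \<open>y\<close>.\<close>
  then have y: "even n" "cdeg c' y a < d" using z full b \<open>x \<noteq> y\<close> by auto
  moreover have "d \<le> cdeg c x a + 1"
    \<comment> \<open>With two units of \<open>a\<close> free at \<open>x\<close>, one would survive
      the swap and match the one freed at \<open>y\<close>.\<close>
    using missing_disjoint[OF nc' xy a(1)] x(2) y vsn \<open>x \<noteq> y\<close> by fastforce
  ultimately show ?thesis using trail vsn by blast
qed

text \<open>Hence the total slack at an end of the uncolored edge counts its missing colors.\<close>

lemma near_coloring_slack_le_1:
  assumes c: "near_coloring G d k c e0" and x: "x \<in> ends G e0" and a: "a < k"
  shows "d \<le> cdeg c x a + 1"
proof (cases "cdeg c x a < d")
  case True
  have "e0 \<in> edges G" using c by (auto simp: near_coloring_def)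
  then obtain y where xy: "ends G e0 = {x, y}" using x by (elim other_end)
  then obtain b where "b < k" "cdeg c y b < d" using near_coloring_missing[OF c, of y] by auto
  then show ?thesis using kempe_closes[OF c xy a True] by blast
qed auto

text \<open>The chain starting in \<open>w\<close> avoids both ends of the uncolored edge, since otherwise
  swapping it would make these ends miss a common color.\<close>

lemma transfer_missing_color:
  assumes c: "near_coloring G d k c e0" and xy: "ends G e0 = {x, y}"
    and \<gamma>: "\<gamma> < k" "cdeg c x \<gamma> < d" and \<delta>: "\<delta> < k" "cdeg c y \<delta> < d"
    and w: "w \<noteq> x" "w \<noteq> y" "cdeg c w \<gamma> < d" "\<not> cdeg c w \<delta> < d"
  obtains S where "near_coloring G d k (swap_colors \<gamma> \<delta> S c) e0"
    "\<And>i. cdeg (swap_colors \<gamma> \<delta> S c) y i = cdeg c y i"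
    "\<And>u i. i \<noteq> \<gamma> \<Longrightarrow> i \<noteq> \<delta> \<Longrightarrow> cdeg (swap_colors \<gamma> \<delta> S c) u i = cdeg c u i"
    "cdeg (swap_colors \<gamma> \<delta> S c) w \<delta> < d"
proof -
  have bound: "cdeg c u i \<le> d" if "i < k" for u i using c that by (auto simp: near_coloring_def)
  have "\<not> cdeg c x \<delta> < d" "\<not> cdeg c y \<gamma> < d"
    using \<gamma> \<delta> missing_disjoint[OF c xy] by blast+
  then have full: "cdeg c x \<delta> = d" "cdeg c y \<gamma> = d" "cdeg c w \<delta> = d"
    using w(4) bound[OF \<delta>(1), of x] bound[OF \<gamma>(1), of y] bound[OF \<delta>(1), of w] by auto
  then have "\<gamma> \<noteq> \<delta>" "cdeg c w \<gamma> < cdeg c w \<delta>" using w by auto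
  then obtain n vs es c' where
    "alternating_trail G c \<gamma> \<delta> vs es n" "vs 0 = w" and c': "c' = swap_colors \<gamma> \<delta> (es ` {..<n}) c"
    and away: "\<And>u i. u \<noteq> w \<Longrightarrow> u \<noteq> vs n \<Longrightarrow> cdeg c' u i = cdeg c u i"
    and other: "\<And>u i. i \<noteq> \<gamma> \<Longrightarrow> i \<noteq> \<delta> \<Longrightarrow> cdeg c' u i = cdeg c u i"
    and le: "\<And>u. cdeg c' u \<gamma> \<le> max (cdeg c u \<gamma>) (cdeg c u \<delta>)"
      "\<And>u. cdeg c' u \<delta> \<le> max (cdeg c u \<gamma>) (cdeg c u \<delta>)"
    and wd: "cdeg c' w \<delta> < cdeg c w \<delta>" "vs n \<noteq> w \<Longrightarrow> cdeg c' w \<gamma> = cdeg c w \<gamma> + 1"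
    and z: "vs n \<noteq> w \<Longrightarrow> cdeg c (vs n) \<gamma> < cdeg c (vs n) \<delta> \<and> odd n \<and>
         cdeg c' (vs n) \<gamma> = cdeg c (vs n) \<gamma> + 1 \<and> cdeg c' (vs n) \<delta> + 1 = cdeg c (vs n) \<delta> \<or>
       cdeg c (vs n) \<delta> < cdeg c (vs n) \<gamma> \<and> even n \<and>
         cdeg c' (vs n) \<delta> = cdeg c (vs n) \<delta> + 1 \<and> cdeg c' (vs n) \<gamma> + 1 = cdeg c (vs n) \<gamma>"
    by (rule kempe_chain) (rule that)
  have nc': "near_coloring G d k c' e0"
    unfolding c' by (rule near_coloring_swap[OF c \<gamma>(1) \<delta>(1)]) (use le other c' in auto)
  have "e0 \<in> edges G" using c by (auto simp: near_coloring_def)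
  then have "x \<noteq> y" using loopless xy by fastforce
  \<comment> \<open>Ending in \<open>x\<close>, the chain would free \<open>\<delta>\<close> there,
    which \<open>y\<close> misses already; ending in \<open>y\<close>, it would free
    \<open>\<gamma>\<close> there, which \<open>x\<close> misses.\<close>
  have "vs n \<noteq> x"
  proof
    assume "vs n = x"
    then show False using z w full \<gamma> \<delta> away[of y \<delta>] missing_disjoint[OF nc' xy \<delta>(1)] \<open>x \<noteq> y\<close> by auto
  qed
  moreover have "vs n \<noteq> y"
  proof
    assume "vs n = y"
    then show False using z w full \<gamma> \<delta> away[of x \<gamma>] missing_disjoint[OF nc' xy \<gamma>(1)] \<open>x \<noteq> y\<close> by auto
  qed
  ultimately show thesis using that[of "es ` {..<n}"] nc' away w wd full other c' by auto
qed

section \<open>Kempe circuits and missing colors along them\<close>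

text \<open>The sequences \<open>vs\<close> and \<open>es\<close> are periodic, so that shifting them rotates the trail.
  The uncolored edge \<open>es (N - 1)\<close> joins \<open>vs (N - 1)\<close> to \<open>vs N = vs 0\<close>.\<close>

definition kempe_circuit :: "('e \<Rightarrow> nat) \<Rightarrow> nat \<Rightarrow> nat \<Rightarrow> (nat \<Rightarrow> 'v) \<Rightarrow> (nat \<Rightarrow> 'e) \<Rightarrow> nat \<Rightarrow> bool" where
  "kempe_circuit c a b vs es N \<longleftrightarrow> odd N \<and> inj_on es {..<N} \<and>
     (\<forall>i. vs (i + N) = vs i \<and> es (i + N) = es i \<and> es i \<in> edges G \<and> ends G (es i) = {vs i, vs (Suc i)}) \<and>
     a < k \<and> b < k \<and> a \<noteq> b \<and> near_coloring G d k c (es (N - 1)) \<and>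
     (\<forall>i<N - 1. c (es i) = (if even i then b else a)) \<and>
     cdeg c (vs 0) a < d \<and> cdeg c (vs (N - 1)) b < d"

lemma kempe_circuitD:
  assumes "kempe_circuit c a b vs es N"
  shows "odd N" "inj_on es {..<N}" "vs (i + N) = vs i" "es (i + N) = es i" "es i \<in> edges G"
    "ends G (es i) = {vs i, vs (Suc i)}" "a < k" "b < k" "a \<noteq> b" "near_coloring G d k c (es (N - 1))"
    "i < N - 1 \<Longrightarrow> c (es i) = (if even i then b else a)"
    "cdeg c (vs 0) a < d" "cdeg c (vs (N - 1)) b < d"
    "ends G (es (N - 1)) = {vs 0, vs (N - 1)}" "vs i \<noteq> vs (Suc i)" "2 < N"
proof -
  show "odd N" "inj_on es {..<N}" "vs (i + N) = vs i" "es (i + N) = es i" and e: "es i \<in> edges G"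
    "ends G (es i) = {vs i, vs (Suc i)}" for i
    using assms by (auto simp: kempe_circuit_def)
  show "a < k" "b < k" "a \<noteq> b" "near_coloring G d k c (es (N - 1))"
    "i < N - 1 \<Longrightarrow> c (es i) = (if even i then b else a)"
    "cdeg c (vs 0) a < d" "cdeg c (vs (N - 1)) b < d"
    using assms by (auto simp: kempe_circuit_def)
  have N: "odd N" "vs (0 + N) = vs 0" using assms unfolding kempe_circuit_def by blast+
  then have "0 < N" by (cases N) auto
  then have "Suc (N - 1) = N" by simp
  then show "ends G (es (N - 1)) = {vs 0, vs (N - 1)}" using e(2)[of "N - 1"] N by auto
  show ne: "vs i \<noteq> vs (Suc i)" for i using e[of i] loopless[of "es i"] by auto
  have "N \<noteq> 1" using ne[of 0] N by auto
  then show "2 < N" using N \<open>0 < N\<close> by (cases "N = 2") auto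
qed

text \<open>Color \<open>b\<close> moves from \<open>es 0\<close> to the uncolored edge. At
  \<open>vs 0\<close> this cancels, at \<open>vs (N - 1)\<close> there is room, and
  \<open>vs 1\<close> is left missing \<open>b\<close>; hence the two colors trade roles.\<close>

lemma rotate_kempe_circuit:
  assumes K: "kempe_circuit c a b vs es N"
  obtains c' where "kempe_circuit c' b a (\<lambda>i. vs (Suc i)) (\<lambda>i. es (Suc i)) N"
    "\<And>v i. i < k \<Longrightarrow> i \<noteq> a \<Longrightarrow> i \<noteq> b \<Longrightarrow> cdeg c' v i = cdeg c v i"
proof -
  note D = kempe_circuitD[OF K]
  define e0 where "e0 = es (N - 1)"
  define c1 where "c1 = c(e0 := b)"
  define c' where "c' = c1(es 0 := k)"
  have e: "e0 \<in> edges G" "es 0 \<in> edges G" using D(5) by (auto simp: e0_def)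
  have "es 0 \<noteq> e0" using D(2,16) by (auto simp: e0_def dest: inj_onD)
  have "c e0 = k" using D(10) by (simp add: near_coloring_def e0_def)
  have "c1 (es 0) = b" using D(11)[of 0] D(16) \<open>es 0 \<noteq> e0\<close> by (simp add: c1_def)
  have ends: "ends G e0 = {vs 0, vs (N - 1)}" using D(14) by (simp add: e0_def)
  have ends0: "ends G (es 0) = {vs 0, vs 1}" using D(6)[of 0] by simp
  have deg: "cdeg c' v i + of_bool (v \<in> {vs 0, vs 1} \<and> b = i) =
      cdeg c v i + of_bool (v \<in> {vs 0, vs (N - 1)} \<and> b = i)" if "i < k" for v i
    using cdeg_upd[OF e(1), of c b v i] cdeg_upd[OF e(2), of c1 k v i] that \<open>c e0 = k\<close> \<open>c1 (es 0) = b\<close>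
      ends ends0 by (simp add: c1_def[symmetric] c'_def[symmetric])
  have ne: "vs 0 \<noteq> vs 1" using D(15)[of 0] by simp
  have ne': "vs 0 \<noteq> vs (N - 1)" using D(15)[of "N - 1"] D(3)[of 0] D(16) by auto
  have bound: "cdeg c v i \<le> d" if "i < k" for v i using D(10) that by (auto simp: near_coloring_def)
  have nc': "near_coloring G d k c' (es 0)"
    unfolding near_coloring_def
  proof (intro conjI allI impI)
    show "\<forall>e\<in>edges G - {es 0}. c' e < k"
      using D(10,8) by (auto simp: c'_def c1_def near_coloring_def e0_def)
    show "cdeg c' v i \<le> d" if "i < k" for v i
      using deg[OF that, of v] bound[OF that, of v] D(13) ne ne'
      by (cases "b = i \<and> v = vs (N - 1)") (auto simp: of_bool_def split: if_splits)
  qed (use e in \<open>auto simp: c'_def\<close>)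
  have "cdeg c' (vs 0) a < d" using deg[OF D(7), of "vs 0"] D(9,12) by simp
  \<comment> \<open>If \<open>vs 1\<close> is \<open>vs (N - 1)\<close>, gain and loss cancel, but
    \<open>b\<close> was missing there from the start.\<close>
  moreover have "cdeg c' (vs 1) b < d"
    using deg[OF D(8), of "vs 1"] D(13) bound[OF D(8), of "vs 1"] ne
    by (cases "vs 1 = vs (N - 1)") auto
  moreover have "c' (es (Suc i)) = (if even i then a else b)" if "i < N - 1" for i
  proof (cases "Suc i = N - 1")
    case True
    then have "odd i" using D(1) by (metis dvd_diffD1 even_Suc less_imp_le odd_even_add odd_one odd_pos Suc_leI even_diff_nat)
    then show ?thesis using True \<open>es 0 \<noteq> e0\<close> by (auto simp: c'_def c1_def e0_def)
  next
    case False
    then have "es (Suc i) \<noteq> e0" "es (Suc i) \<noteq> es 0"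
      using that D(2) by (auto simp: e0_def dest: inj_onD)
    then show ?thesis using that False D(11)[of "Suc i"] by (auto simp: c'_def c1_def)
  qed
  moreover have "inj_on (\<lambda>i. es (Suc i)) {..<N}"
  proof (rule linorder_inj_onI)
    fix i j assume ij: "i < j" "i \<in> {..<N}" "j \<in> {..<N}"
    then show "es (Suc i) \<noteq> es (Suc j)"
      using D(2) D(4)[of 0] by (cases "Suc j = N") (auto dest: inj_onD)
  qed auto
  moreover have "es N = es 0" "vs N = vs 0" "Suc (N - 1) = N" using D(3,4)[of 0] D(16) by auto
  ultimately have "kempe_circuit c' b a (\<lambda>i. vs (Suc i)) (\<lambda>i. es (Suc i)) N"
    using nc' D(1,3,4,5,6,7,8,9) by (auto simp: kempe_circuit_def simp flip: add_Suc)
  moreover have "cdeg c' v i = cdeg c v i" if "i < k" "i \<noteq> a" "i \<noteq> b" for v i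
    using deg[of i v] that by auto
  ultimately show thesis by (rule that)
qed

text \<open>Each rotation exchanges the two colors, so only the unordered pair is kept.\<close>

lemma shift_kempe_circuit:
  assumes K: "kempe_circuit c a b vs es N"
  shows "\<exists>c' a' b'. {a', b'} = {a, b} \<and> kempe_circuit c' a' b' (\<lambda>i. vs (i + j)) (\<lambda>i. es (i + j)) N \<and>
    (\<forall>v i. i < k \<longrightarrow> i \<notin> {a, b} \<longrightarrow> cdeg c' v i = cdeg c v i)"
proof (induction j)
  case 0
  then show ?case using K by auto
next
  case (Suc j)
  then obtain c' a' b' where
    *: "{a', b'} = {a, b}" "kempe_circuit c' a' b' (\<lambda>i. vs (i + j)) (\<lambda>i. es (i + j)) N"
    "\<forall>v i. i < k \<longrightarrow> i \<notin> {a, b} \<longrightarrow> cdeg c' v i = cdeg c v i"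
    by (elim exE conjE) (rule that; assumption)
  from *(2) obtain c'' where
    **: "kempe_circuit c'' b' a' (\<lambda>i. vs (Suc i + j)) (\<lambda>i. es (Suc i + j)) N"
    "\<And>v i. i < k \<Longrightarrow> i \<noteq> a' \<Longrightarrow> i \<noteq> b' \<Longrightarrow> cdeg c'' v i = cdeg c' v i"
    by (rule rotate_kempe_circuit) (rule that; assumption)
  have "{b', a'} = {a, b}" using *(1) by (simp only: insert_commute)
  moreover have "kempe_circuit c'' b' a' (\<lambda>i. vs (i + Suc j)) (\<lambda>i. es (i + Suc j)) N"
    using **(1) by (simp only: add_Suc add_Suc_right)
  moreover have "\<forall>v i. i < k \<longrightarrow> i \<notin> {a, b} \<longrightarrow> cdeg c'' v i = cdeg c v i"
    using *(1,3) **(2) by (metis insert_iff)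
  ultimately show ?case by (intro exI[of _ c''] exI[of _ b'] exI[of _ a'] conjI)
qed

text \<open>Rotating the circuit changes color degrees only in \<open>a\<close> and
  \<open>b\<close>; leaving these out makes the set invariant under rotation.\<close>

definition missing :: "('e \<Rightarrow> nat) \<Rightarrow> nat \<Rightarrow> nat \<Rightarrow> 'v \<Rightarrow> nat set" where
  "missing c a b v = {i. i < k \<and> i \<notin> {a, b} \<and> cdeg c v i < d}"

text \<open>Rotate until the uncolored edge ends in \<open>vs j\<close>. The slack there is at least
  \<open>r + 1\<close>; \<open>a'\<close> contributes at most one unit, and \<open>b'\<close> none,
  as it is missing at the other end. Every other missing color contributes one.\<close>

lemma card_missing_ge:
  assumes K: "kempe_circuit c a b vs es N"
  shows "r \<le> card (missing c a b (vs j))"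
proof -
  obtain c' a' b' where
    *: "{a', b'} = {a, b}" "kempe_circuit c' a' b' (\<lambda>i. vs (i + j)) (\<lambda>i. es (i + j)) N"
    "\<forall>v i. i < k \<longrightarrow> i \<notin> {a, b} \<longrightarrow> cdeg c' v i = cdeg c v i"
    using shift_kempe_circuit[OF K, of j] by (elim exE conjE) (rule that; assumption)
  note D = kempe_circuitD[OF *(2)]
  define M where "M = missing c a b (vs j)"
  have x: "vs j \<in> ends G (es (N - 1 + j))" using D(14) by simp
  have slack: "d - cdeg c' (vs j) i \<le> of_bool (i \<in> M) + of_bool (i = a')" if "i < k" for i
  proof -
    have "d \<le> cdeg c' (vs j) i + 1" by (rule near_coloring_slack_le_1[OF D(10) x that])
    moreover have "\<not> cdeg c' (vs j) b' < d"
      using missing_disjoint[OF D(10) D(14) D(8)] D(13) by auto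
    moreover have "i \<in> M" if "i \<notin> {a', b'}" "cdeg c' (vs j) i < d"
      using *(1,3) that \<open>i < k\<close> by (auto simp: M_def missing_def)
    ultimately show ?thesis by (cases "i = a'"; cases "i = b'"; cases "cdeg c' (vs j) i < d") auto
  qed
  have "Suc r \<le> (\<Sum>i<k. d - cdeg c' (vs j) i)" using near_coloring_slack[OF D(10) x] .
  also have "\<dots> \<le> (\<Sum>i<k. of_bool (i \<in> M) + of_bool (i = a'))" using slack by (intro sum_mono) auto
  also have "\<dots> = card M + 1"
  proof -
    have "{..<k} \<inter> {i. i \<in> M} = M" "{..<k} \<inter> {i. i = a'} = {a'}"
      using D(7) by (auto simp: M_def missing_def)
    then show ?thesis using D(7) by (simp add: sum.distrib of_bool_def sum.If_cases)
  qed
  finally show ?thesis by (simp add: M_def)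
qed

lemma kempe_circuit_swap:
  assumes K: "kempe_circuit c a b vs es N" and "\<gamma> \<notin> {a, b}" "\<gamma> < k" "\<delta> \<notin> {a, b}" "\<delta> < k"
    and "near_coloring G d k (swap_colors \<gamma> \<delta> S c) (es (N - 1))"
    and "\<And>u i. i \<noteq> \<gamma> \<Longrightarrow> i \<noteq> \<delta> \<Longrightarrow> cdeg (swap_colors \<gamma> \<delta> S c) u i = cdeg c u i"
  shows "kempe_circuit (swap_colors \<gamma> \<delta> S c) a b vs es N"
proof -
  have "swap_colors \<gamma> \<delta> S c (es i) = c (es i)" if "i < N - 1" for i
    using kempe_circuitD(11)[OF K that] assms(2,4) by (auto simp: swap_colors_def)
  then show ?thesis using assms unfolding kempe_circuit_def by simp
qed

text \<open>Induction on the distance along the circuit: with the uncolored edge rotated to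
  \<open>es i\<close>, a Kempe swap from the farther vertex makes it share a color with \<open>vs (i + 1)\<close>.\<close>

lemma missing_disjoint_on_circuit:
  assumes "kempe_circuit c a b vs es N" "vs i \<noteq> vs (i + t)"
    "\<gamma> \<in> missing c a b (vs i)" "\<gamma> \<in> missing c a b (vs (i + t))"
  shows False
  using assms
proof (induction t arbitrary: c a b vs es i \<gamma>)
  case 0
  then show ?case by simp
next
  case (Suc t)
  obtain c' a' b' where
    ab': "{a', b'} = {a, b}"
    and K': "kempe_circuit c' a' b' (\<lambda>j. vs (j + Suc i)) (\<lambda>j. es (j + Suc i)) N"
    and same: "\<forall>v i. i < k \<longrightarrow> i \<notin> {a, b} \<longrightarrow> cdeg c' v i = cdeg c v i"
    using shift_kempe_circuit[OF Suc.prems(1), of "Suc i"] by (elim exE conjE) (rule that; assumption)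
  define vs' where "vs' = (\<lambda>j. vs (j + Suc i))"
  define es' where "es' = (\<lambda>j. es (j + Suc i))"
  have K: "kempe_circuit c' a' b' vs' es' N" using K' by (simp add: vs'_def es'_def)
  note D = kempe_circuitD[OF K]
  \<comment> \<open>After the shift by \<open>i + 1\<close> the uncolored edge joins
    \<open>vs i\<close> to \<open>vs (i + 1)\<close>, and the far vertex is \<open>t\<close> steps
    from the latter.\<close>
  have "N - 1 + Suc i = i + N" using D(16) by simp
  then have last: "vs' (N - 1) = vs i"
    using kempe_circuitD(3)[OF Suc.prems(1), of i] unfolding vs'_def by (simp only:)
  have vt: "vs' t = vs (i + Suc t)" by (simp add: vs'_def add.commute)
  have same_missing: "missing c' a' b' v = missing c a b v" for v
    using same ab' by (auto simp: missing_def)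
  define x where "x = vs' (N - 1)"
  define y where "y = vs' 0"
  define w where "w = vs' t"
  have xy: "ends G (es' (N - 1)) = {x, y}" using D(14) by (auto simp: x_def y_def)
  have \<gamma>: "\<gamma> \<in> missing c' a' b' x" "\<gamma> \<in> missing c' a' b' w"
    using Suc.prems(3,4) unfolding same_missing x_def w_def last vt by auto
  have wx: "w \<noteq> x" using Suc.prems(2) unfolding x_def w_def last vt by auto
  have wy: "w \<noteq> y" using missing_disjoint[OF D(10) xy] \<gamma> by (auto simp: missing_def)
  have "card (missing c' a' b' y) \<noteq> 0" using card_missing_ge[OF K, of 0] r_pos by (simp add: y_def)
  then obtain \<delta> where \<delta>: "\<delta> \<in> missing c' a' b' y" by fastforce
  show False
  \<comment> \<open>Either way \<open>y\<close> and \<open>w\<close>, only \<open>t\<close> steps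
    apart, come to miss \<open>\<delta>\<close> together: if \<open>w\<close> does not yet, a swap
    of \<open>\<gamma>\<close> and \<open>\<delta>\<close> achieves it without changing the degrees
    at \<open>y\<close> or the colors on the circuit.\<close>
  proof (cases "cdeg c' w \<delta> < d")
    case True
    then have "\<delta> \<in> missing c' a' b' w" using \<delta> by (auto simp: missing_def)
    then show False using Suc.IH[OF K, of 0] \<delta> wy by (simp add: y_def w_def)
  next
    case False
    have c: "\<gamma> < k" "cdeg c' x \<gamma> < d" "\<delta> < k" "cdeg c' y \<delta> < d" "cdeg c' w \<gamma> < d"
      "\<gamma> \<notin> {a', b'}" "\<delta> \<notin> {a', b'}" using \<gamma> \<delta> by (auto simp: missing_def)
    obtain S where S: "near_coloring G d k (swap_colors \<gamma> \<delta> S c') (es' (N - 1))"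
      "\<And>i. cdeg (swap_colors \<gamma> \<delta> S c') y i = cdeg c' y i"
      "\<And>u i. i \<noteq> \<gamma> \<Longrightarrow> i \<noteq> \<delta> \<Longrightarrow> cdeg (swap_colors \<gamma> \<delta> S c') u i = cdeg c' u i"
      "cdeg (swap_colors \<gamma> \<delta> S c') w \<delta> < d"
      using transfer_missing_color[OF D(10) xy c(1-4) wx wy c(5) False] by metis
    have "kempe_circuit (swap_colors \<gamma> \<delta> S c') a' b' vs' es' N"
      by (rule kempe_circuit_swap[OF K c(6,1,7,3) S(1,3)])
    moreover have "\<delta> \<in> missing (swap_colors \<gamma> \<delta> S c') a' b' y" "\<delta> \<in> missing (swap_colors \<gamma> \<delta> S c') a' b' w"
      using S(2,4) c by (auto simp: missing_def)
    ultimately show False using Suc.IH[of "swap_colors \<gamma> \<delta> S c'" a' b' vs' es' 0 \<delta>] wy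
      by (simp add: y_def w_def)
  qed
qed

section \<open>A short odd cycle from a near coloring\<close>

text \<open>The trail of \<open>kempe_closes\<close> has even length, and \<open>e0\<close> closes
  it to an odd circuit.\<close>

lemma kempe_circuit_exists:
  assumes c: "near_coloring G d k c e0"
  obtains a b vs es N where "kempe_circuit c a b vs es N"
proof -
  have e0: "e0 \<in> edges G" "c e0 = k" using c by (auto simp: near_coloring_def)
  then obtain x y where xy: "ends G e0 = {x, y}" using loopless[OF e0(1)] by (auto simp: card_2_iff)
  obtain a where a: "a < k" "cdeg c x a < d" using near_coloring_missing[OF c, of x] xy by auto
  obtain b where b: "b < k" "cdeg c y b < d" using near_coloring_missing[OF c, of y] xy by auto
  have "a \<noteq> b" using missing_disjoint[OF c xy] a b by blast
  obtain n vs es where trail: "alternating_trail G c a b vs es n" and v: "vs 0 = x" "vs n = y" and "even n"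
    using kempe_closes[OF c xy a b] by blast
  \<comment> \<open>Reducing indices modulo \<open>n + 1\<close> makes the sequences periodic, with
    \<open>e0\<close> in position \<open>n\<close>.\<close>
  define vs' where "vs' i = vs (i mod Suc n)" for i
  define es' where "es' i = (if i mod Suc n = n then e0 else es (i mod Suc n))" for i
  have col: "c (es i) < k" if "i < n" for i using trail that a b by (auto simp: alternating_trail_def)
  have "kempe_circuit c a b vs' es' (Suc n)"
    unfolding kempe_circuit_def
  proof (intro conjI allI impI)
    show "inj_on es' {..<Suc n}"
    proof (rule linorder_inj_onI')
      fix i j assume ij: "i \<in> {..<Suc n}" "j \<in> {..<Suc n}" "i < j"
      moreover have "es i \<noteq> e0" using col[of i] e0 ij by auto
      moreover have "es i \<noteq> es j" if "j < n"
        using trail ij that by (auto simp: alternating_trail_def dest: inj_onD)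
      ultimately show "es' i \<noteq> es' j" by (auto simp: es'_def less_Suc_eq)
    qed
    fix i
    have "i mod Suc n < Suc n" by simp
    then consider "i mod Suc n < n" | "i mod Suc n = n" by linarith
    then show "ends G (es' i) = {vs' i, vs' (Suc i)}"
    proof cases
      case 1
      then show ?thesis using trail by (simp add: es'_def vs'_def alternating_trail_def mod_Suc)
    next
      case 2
      then show ?thesis using xy v by (auto simp: es'_def vs'_def mod_Suc)
    qed
    show "es' i \<in> edges G" using trail e0 \<open>i mod Suc n < Suc n\<close>
      by (auto simp: es'_def alternating_trail_def less_Suc_eq)
  qed (use trail c a b v \<open>a \<noteq> b\<close> \<open>even n\<close> in
      \<open>auto simp: es'_def vs'_def alternating_trail_def simp del: add_Suc_right\<close>)
  then show thesis using that by blast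
qed

text \<open>The vertices of a cycle inside the circuit have pairwise disjoint sets of at least
  \<open>r\<close> missing colors each, all among the \<open>k - 2\<close> colors other than
  \<open>a\<close> and \<open>b\<close>.\<close>

lemma near_coloring_short_odd_cycle:
  assumes c: "near_coloring G d k c e0"
  obtains cvs ces where "is_cycle G cvs ces" "odd (length ces)" "r * length ces + 2 \<le> k"
proof -
  obtain a b vs es N where K: "kempe_circuit c a b vs es N" using kempe_circuit_exists[OF c] by blast
  note D = kempe_circuitD[OF K]
  obtain cvs ces where cyc: "is_cycle G cvs ces" "odd (length ces)" "set cvs \<subseteq> vs ` {..<N}"
    using odd_closed_trail_contains_cycle[OF D(1,2), of vs] D(3)[of 0] D(5,6) by auto
  define M where "M = missing c a b"
  have M: "M v \<subseteq> {..<k} - {a, b}" for v by (auto simp: M_def missing_def)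
  have "M u \<inter> M v = {}" if uv: "u \<in> set cvs" "v \<in> set cvs" "u \<noteq> v" for u v
  proof -
    obtain i j where ij: "u = vs i" "v = vs j" using uv cyc(3) by blast
    have "\<gamma> \<notin> M u \<inter> M v" for \<gamma>
    \<comment> \<open>Distances run forward along the circuit, so the smaller index comes
      first.\<close>
    proof (cases "i \<le> j")
      case True
      then show ?thesis using missing_disjoint_on_circuit[OF K, of i "j - i"] ij uv by (auto simp: M_def)
    next
      case False
      then show ?thesis using missing_disjoint_on_circuit[OF K, of j "i - j"] ij uv by (auto simp: M_def)
    qed
    then show ?thesis by blast
  qed
  then have "(\<Sum>v\<in>set cvs. card (M v)) = card (\<Union>v\<in>set cvs. M v)"
    using finite_subset[OF M] by (subst card_UN_disjoint) auto
  also have "\<dots> \<le> card ({..<k} - {a, b})" using M by (intro card_mono) auto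
  also have "\<dots> = k - 2" using D(7,8,9) by (subst card_Diff_subset) auto
  finally have "(\<Sum>v\<in>set cvs. card (M v)) \<le> k - 2" .
  moreover have "(\<Sum>v\<in>set cvs. r) \<le> (\<Sum>v\<in>set cvs. card (M v))"
    using card_missing_ge[OF K] cyc(3) by (intro sum_mono) (auto simp: M_def)
  moreover have "card (set cvs) = length ces" using cyc(1) by (simp add: is_cycle_def distinct_card)
  ultimately have "r * length ces \<le> k - 2" by (simp add: mult.commute)
  moreover have "2 \<le> k" using D(7,8,9) by linarith
  ultimately show thesis using that cyc(1,2) by simp
qed

end

section \<open>Coloring all edges, and the bound on the index\<close>

text \<open>Edges are added one by one. The degree bound and the cycle condition pass to subgraphs,
  so if the new edge could not be accommodated, \<open>near_coloring_short_odd_cycle\<close> would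
  give an odd cycle of \<open>G\<close> that is too short.\<close>

lemma (in multigraph) bounded_coloring_exists:
  assumes deg: "\<And>v. degree G v + r \<le> k * d" and "0 < r"
    and cyc: "\<And>cvs ces. is_cycle G cvs ces \<Longrightarrow> odd (length ces) \<Longrightarrow> k \<le> r * length ces + 1"
  shows "\<exists>c. bounded_coloring G d k c"
proof -
  have "\<exists>c. bounded_coloring (edge_subgraph G F) d k c" if "F \<subseteq> edges G" for F
    using finite_subset[OF that finite_edges] that
  proof (induction F rule: finite_induct)
    case empty
    then show ?case by (simp add: bounded_coloring_def edge_subgraph_def color_degree_def)
  next
    case (insert e F)
    define H where "H = edge_subgraph G (insert e F)"
    have H: "edges H = insert e F" "ends H = ends G" "verts H = verts G" by (simp_all add: H_def edge_subgraph_def)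
    obtain c where c: "bounded_coloring (edge_subgraph G F) d k c" using insert by auto
    have "near_coloring H d k (c(e := k)) e"
    proof -
      have "{f \<in> edges H. v \<in> ends H f \<and> (c(e := k)) f = i} = {f \<in> F. v \<in> ends G f \<and> c f = i}"
        if "i < k" for v i using that insert.hyps by (auto simp: H)
      then show ?thesis using c insert.hyps
        by (auto simp: near_coloring_def bounded_coloring_def color_degree_def H edge_subgraph_def)
    qed
    moreover have "\<not> uncolorable H d k r \<or> (\<exists>cvs ces. is_cycle H cvs ces \<and> odd (length ces) \<and> r * length ces + 2 \<le> k)"
      using uncolorable.near_coloring_short_odd_cycle calculation by metis
    moreover have "is_cycle G cvs ces" if "is_cycle H cvs ces" for cvs ces
      using that insert.prems by (auto simp: is_cycle_def H)
    ultimately have "\<not> uncolorable H d k r" using cyc by fastforce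
    moreover have "degree H v + r \<le> k * d" for v
    proof -
      have "degree H v \<le> degree G v"
        unfolding degree_def using insert.prems finite_edges by (intro card_mono) (auto simp: H)
      then show ?thesis using deg[of v] by linarith
    qed
    moreover have "multigraph H" unfolding H_def by (rule multigraph_edge_subgraph) (use insert in auto)
    ultimately show ?case
      using \<open>0 < r\<close> by (auto simp: uncolorable_def uncolorable_axioms_def H_def)
  qed
  from this[of "edges G"] show ?thesis by (simp add: edge_subgraph_def)
qed

theorem corollary3p1:
  fixes G :: "('v, 'e) pre_multigraph" and d m s :: nat and l :: int
  assumes "multigraph G"
    and "\<not> bipartite G"
    and "d > 1" and "odd d"
    and "max_degree G = m * d + s" and "s < d"
    and "l = max 1 (defective_density G d - int m)"
  shows "l * int d - int s > 0 \<and>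
    (int (odd_girth G) \<ge> \<lceil>real_of_int (int m + l - 1) / real_of_int (l * int d - int s)\<rceil> \<longrightarrow>
       int (defective_chromatic_index G d) \<le> int m + l \<and>
       int (defective_chromatic_index G d)
         \<le> max (defective_density G d) \<lceil>real (max_degree G + 1) / real d\<rceil>)"
proof -
  interpret multigraph G by fact
  have "1 \<le> l" using assms(7) by simp
  then have "int d \<le> l * int d" by (simp add: mult_le_cancel_right1)
  then have pos: "l * int d - int s > 0" using \<open>s < d\<close> by linarith
  define k where "k = nat (int m + l)"
  define r where "r = nat (l * int d - int s)"
  have k: "int k = int m + l" using \<open>1 \<le> l\<close> by (simp add: k_def)
  have r: "int r = l * int d - int s" using pos by (simp add: r_def)
  have "int (max_degree G + r) = int (k * d)" using r k assms(5) by (simp add: algebra_simps)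
  then have deg: "degree G v + r \<le> k * d" for v using degree_le_max_degree[of v] by linarith
  have "int (defective_chromatic_index G d) \<le> int m + l"
    if g: "int (odd_girth G) \<ge> \<lceil>real_of_int (int m + l - 1) / real_of_int (l * int d - int s)\<rceil>"
  proof -
    \<comment> \<open>The girth hypothesis bounds \<open>(k - 1) / r\<close> by the odd girth, hence
      by the length of every odd cycle.\<close>
    have "k \<le> r * length ces + 1" if "is_cycle G cvs ces" "odd (length ces)" for cvs ces
    proof -
      have "odd_girth G \<le> length ces"
        unfolding odd_girth_def by (rule Least_le) (use that in blast)
      moreover have "(real k - 1) / real r \<le> real (odd_girth G)"
        using g by (simp add: ceiling_le_iff flip: k r)
      ultimately have "(real k - 1) / real r \<le> real (length ces)" by linarith
      then have "real k - 1 \<le> real (r * length ces)"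
        using pos r by (simp add: divide_le_eq mult.commute)
      then show ?thesis by linarith
    qed
    then obtain c where "bounded_coloring G d k c"
      using bounded_coloring_exists[OF deg] pos r by fastforce
    then show ?thesis using defective_chromatic_index_le k by fastforce
  qed
  \<comment> \<open>For \<open>l > 1\<close> the sum \<open>m + l\<close> is the density; for
    \<open>l = 1\<close> it is at most the ceiling, because
    \<open>\<Delta>(G) + 1 > m d\<close>.\<close>
  moreover have "int m + l \<le> max (defective_density G d) \<lceil>real (max_degree G + 1) / real d\<rceil>"
  proof -
    have "real m < real (max_degree G + 1) / real d"
      using \<open>d > 1\<close> assms(5) by (simp add: less_divide_eq)
    then have "int m + 1 \<le> \<lceil>real (max_degree G + 1) / real d\<rceil>"
      by (metis add1_zle_eq less_ceiling_iff of_int_of_nat_eq)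
    then show ?thesis using assms(7) by linarith
  qed
  ultimately show ?thesis using pos by linarith
qed

end
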